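(* Let $t$ be a complex number (or indeterminate) with $t\neq 0,-64,-256$, and let $$j=\frac{(t+256)^3}{t^2},\qquad z=\frac{1728}{j},\qquad X=\frac{256t}{(t+64)^2}.$$ Then $z$ and $X$ satisfy $$\begin{aligned}0=\Phi(z,X):={}&729z^2X^3+3888z^2X^2+6912z^2X+4096z^2\\&-1458zX^3+22356zX^2-27648zX+729X^3.\end{aligned}$$ *)

theory Defs
  imports Complex_Main "HOL-Computational_Algebra.Computational_Algebra"
begin

text \<open>
  The parameter \<open>t\<close> may be a complex number or an indeterminate. Both readings are
  instances of \<open>t\<close> being an element of a field of characteristic zero: take the type
  \<^typ>\<open>complex\<close>, or the rational function field \<^typ>\<open>complex poly fract\<close> with
  \<^term>\<open>Fract [:0, 1:] 1 :: complex poly fract\<close> for \<open>t\<close>. The library makes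
  fraction fields a field but does not record their characteristic.
\<close>

instance fract :: ("{idom, ring_char_0}") field_char_0
proof
  show "inj (of_nat :: nat \<Rightarrow> 'a fract)"
    by (rule injI) (simp add: of_nat_fract eq_fract)
qed

definition Phi :: "'a::comm_ring_1 \<Rightarrow> 'a \<Rightarrow> 'a" where
  "Phi z X =
     729 * z^2 * X^3 + 3888 * z^2 * X^2 + 6912 * z^2 * X + 4096 * z^2
     - 1458 * z * X^3 + 22356 * z * X^2 - 27648 * z * X + 729 * X^3"

end

theory Submission
  imports Defs
begin

text \<open>
  \<open>X\<close> is unchanged by the involution \<open>t \<mapsto> 4096 / t\<close>, which sends
  \<open>z = 1728 * t^2 / (t + 256)^3\<close> to \<open>z' = 1728 * t / (t + 16)^3\<close>. The
  polynomial \<open>Phi\<close> is quadratic in its first argument, and its two roots over a given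
  \<open>X\<close> are \<open>z\<close> and \<open>z'\<close>: its leading coefficient is
  \<open>(9 * X + 16)^3\<close>, and
  \<open>(t + 64)^2 * (9 * X + 16) = 16 * (t + 256) * (t + 16)\<close> shows that it is, up to the
  factor \<open>16^3 / (t + 64)^6\<close>, the product of the denominators of \<open>z\<close> and
  \<open>z'\<close>. Lemma \<open>Phi_factorization\<close>
  states the factorization with the denominators cleared, so that it also covers \<open>t = -16\<close>,
  where \<open>z'\<close> has a pole. The theorem is the vanishing of the factor that belongs to
  \<open>z\<close>.
\<close>

text \<open>
  \<open>Phi\<close> has degree 3 in \<open>X\<close>, so the factor \<open>((t + 64)^2)^3\<close> clears
  the denominator of \<open>X\<close>; what remains is a polynomial identity in \<open>t\<close> and
  \<open>w\<close>.
\<close>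

lemma Phi_factorization:
  fixes t w X :: "'a::comm_ring_1"
  assumes X: "X * (t + 64)^2 = 256 * t"
  shows "(t + 64)^6 * Phi w X =
    4096 * ((t + 256)^3 * w - 1728 * t^2) * ((t + 16)^3 * w - 1728 * t)"
proof -
  define s where "s = (t + 64)^2"
  have Xs: "X * s = 256 * t"
    using X by (simp add: s_def)
  have "(t + 64)^6 * Phi w X =
      (729 * w^2 - 1458 * w + 729) * (X * s)^3
      + (3888 * w^2 + 22356 * w) * (X * s)^2 * s
      + (6912 * w^2 - 27648 * w) * (X * s) * s^2
      + 4096 * w^2 * s^3"
  proof -
    have "(t + 64)^6 = s^3"
      by (simp add: s_def flip: power_mult)
    then show ?thesis
      by (simp add: Phi_def algebra_simps power2_eq_square power3_eq_cube)
  qed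
  also have "\<dots> =
      4096 * ((t + 256)^3 * w - 1728 * t^2) * ((t + 16)^3 * w - 1728 * t)"
    unfolding Xs unfolding s_def by (simp add: algebra_simps eval_nat_numeral)
  finally show ?thesis .
qed

theorem lemma1:
  fixes t j z X :: "'a::field_char_0"
  assumes "t \<noteq> 0" and "t \<noteq> -64" and "t \<noteq> -256"
    and "j = (t + 256)^3 / t^2"
    and "z = 1728 / j"
    and "X = 256 * t / (t + 64)^2"
  shows "0 = Phi z X"
proof -
  have t64: "t + 64 \<noteq> 0" and t256: "t + 256 \<noteq> 0"
    using assms(2,3) by (simp_all add: add_eq_0_iff2)
  have "X * (t + 64)^2 = 256 * t"
    using t64 assms(6) by simp
  then have "(t + 64)^6 * Phi z X =
      4096 * ((t + 256)^3 * z - 1728 * t^2) * ((t + 16)^3 * z - 1728 * t)"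
    by (rule Phi_factorization)
  moreover have "(t + 256)^3 * z = 1728 * t^2"
    using t256 assms(4,5) by simp
  ultimately have "(t + 64)^6 * Phi z X = 0"
    by simp
  with t64 show ?thesis
    by simp
qed

end
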